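(* Let $\phi$ be a symmetric gauge on $\mathbb{R}^n$ and let $\phi^\circ$ be its dual norm. Let $X\in\mathbb{S}^n$ have eigendecomposition $X=Q\Lambda(X)Q^\top$ (with $Q$ orthogonal and $\Lambda(X)=\operatorname{diag}(\lambda(X))$) and negative spectrum $\lambda_-(X)\in\mathbb{R}^n_+$. Then the optimal value of the spectral-gauge separation problem is $$g_\phi(X):=\min_{S\in\mathbb{S}^n_+\cap\mathcal{B}_\phi}\langle S,X\rangle=-\phi^\circ(\lambda_-(X)),$$ and there exists an optimal separator $S^\star\in\operatorname{argmin}_{S\in\mathbb{S}^n_+\cap\mathcal{B}_\phi}\langle S,X\rangle$ of the form $$S^\star=Q\operatorname{diag}(z^\star)Q^\top,\quad\text{with } z^\star\in\operatorname{argmax}_{z\in\mathbb{R}^n_+}\{\lambda_-(X)^\top z:\ \phi(z)\le 1\},$$ such that $\operatorname{supp}(z^\star)\subseteq\operatorname{supp}(\lambda_-(X))$. Moreover, either $g_\phi(X)=0$ and $X\in\mathbb{S}^n_+$, or $g_\phi(X)<0$ and the inequality $\langle S^\star,Y\rangle\ge 0$ separates $X$ from $\mathbb{S}^n_+$ (i.e. it holds for all $Y\in\mathbb{S}^n_+$ and $\langle S^\star,X\rangle<0$).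
   Context: $\mathbb{S}^n$ is the space of real symmetric $n\times n$ matrices with the Frobenius inner product $\langle A,B\rangle=\operatorname{tr}(A^\top B)$; $\mathbb{S}^n_+$ is the cone of positive semidefinite matrices. For $X\in\mathbb{S}^n$, $\lambda(X)\in\mathbb{R}^n$ is the vector of eigenvalues in nondecreasing order, repeated with multiplicity, and $\lambda_-(X):=(\max\{-\lambda_i(X),0\})_{i}\in\mathbb{R}^n_+$. The support $\operatorname{supp}(u)$ of a vector $u$ is the set of indices of its nonzero components. A symmetric gauge on $\mathbb{R}^n$ is a norm $\phi$ with $\phi(z)=\phi(|z|)$ (componentwise absolute value) for all $z$ and $\phi(Pz)=\phi(z)$ for every permutation matrix $P$ and all $z$. Its dual norm is $\phi^\circ(y)=\max\{|y^\top z|:\ z\in\mathbb{R}^n,\ \phi(z)\le 1\}$. The unit ball is $\mathcal{B}_\phi:=\{S\in\mathbb{S}^n:\ \phi(\lambda(S))\le 1\}$. *)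

theory Defs
  imports "HOL-Analysis.Analysis"
begin

text \<open>
  The dimension is \<open>CARD('n)\<close>. Where eigenvalues are listed in nondecreasing order, the
  index type is also linearly ordered.
\<close>

definition sym_matrices :: "(real^'n^'n) set" where
  "sym_matrices = {A. transpose A = A}"

definition psd_matrices :: "(real^'n^'n) set" where
  "psd_matrices = {A \<in> sym_matrices. \<forall>v. 0 \<le> v \<bullet> (A *v v)}"

text \<open>The inner product inherited by \<^typ>\<open>real^'n^'n\<close> is the Frobenius inner product.\<close>

lemma inner_eq_trace:
  fixes A B :: "real^'n^'n"
  shows "A \<bullet> B = trace (transpose A ** B)"
  unfolding trace_def transpose_def matrix_matrix_mult_def inner_vec_def
  by (simp, rule sum.swap)

definition diag_matrix :: "real^'n \<Rightarrow> real^'n^'n" where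
  "diag_matrix v = (\<chi> i j. if i = j then v $ i else 0)"

text \<open>
  The nondecreasing vector whose entries are the roots of the characteristic polynomial,
  repeated with multiplicity. It exists for symmetric matrices (spectral theorem) and is unique;
  for other matrices the value is irrelevant.
\<close>

definition eigvals :: "real^'n::{finite,linorder}^'n::{finite,linorder} \<Rightarrow> real^'n::{finite,linorder}" where
  "eigvals X = (THE v. mono (($) v) \<and>
     (\<forall>t::real. det (t *\<^sub>R mat 1 - X) = (\<Prod>i\<in>UNIV. t - v $ i)))"

definition neg_spectrum :: "real^'n::{finite,linorder}^'n::{finite,linorder} \<Rightarrow> real^'n::{finite,linorder}" where
  "neg_spectrum X = (\<chi> i. max (- (eigvals X $ i)) 0)"

definition vec_support :: "real^'n \<Rightarrow> 'n set" where
  "vec_support u = {i. u $ i \<noteq> 0}"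

definition is_norm :: "(real^'n \<Rightarrow> real) \<Rightarrow> bool" where
  "is_norm \<phi> \<longleftrightarrow>
     (\<forall>z. 0 \<le> \<phi> z) \<and> (\<forall>z. \<phi> z = 0 \<longleftrightarrow> z = 0) \<and>
     (\<forall>c z. \<phi> (c *\<^sub>R z) = \<bar>c\<bar> * \<phi> z) \<and> (\<forall>y z. \<phi> (y + z) \<le> \<phi> y + \<phi> z)"

definition symmetric_gauge :: "(real^'n \<Rightarrow> real) \<Rightarrow> bool" where
  "symmetric_gauge \<phi> \<longleftrightarrow> is_norm \<phi> \<and>
     (\<forall>z. \<phi> z = \<phi> (\<chi> i. \<bar>z $ i\<bar>)) \<and>
     (\<forall>p z. p permutes UNIV \<longrightarrow> \<phi> (\<chi> i. z $ p i) = \<phi> z)"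

text \<open>
  \<^const>\<open>Greatest\<close> and \<^const>\<open>Least\<close> render max and min (not sup and inf):
  the value is specified only when the extremum is attained.
\<close>

definition dual_norm :: "(real^'n \<Rightarrow> real) \<Rightarrow> real^'n \<Rightarrow> real" where
  "dual_norm \<phi> y = (GREATEST r. r \<in> {\<bar>y \<bullet> z\<bar> | z. \<phi> z \<le> 1})"

definition gauge_ball :: "(real^'n::{finite,linorder} \<Rightarrow> real) \<Rightarrow> (real^'n::{finite,linorder}^'n::{finite,linorder}) set" where
  "gauge_ball \<phi> = {S \<in> sym_matrices. \<phi> (eigvals S) \<le> 1}"

definition gauge_gap :: "(real^'n::{finite,linorder} \<Rightarrow> real) \<Rightarrow> real^'n::{finite,linorder}^'n::{finite,linorder} \<Rightarrow> real" where
  "gauge_gap \<phi> X = (LEAST r. r \<in> {S \<bullet> X | S. S \<in> psd_matrices \<inter> gauge_ball \<phi>})"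

end

theory Submission
  imports Defs
begin

text \<open>
  Write \<open>y\<close> for the negative spectrum of \<open>X\<close> and let \<open>z\<close> maximize \<open>y \<bullet> z\<close> over the unit ball
  of \<open>\<phi>\<close>. As \<open>y \<ge> 0\<close> and \<open>\<phi>\<close> ignores signs, \<open>z\<close> may be taken nonnegative; entries outside the
  support of \<open>y\<close> do not affect \<open>y \<bullet> z\<close>, and erasing them does not increase \<open>\<phi>\<close>
  (\<open>symmetric_gauge_restrict_le\<close>). Hence \<open>y \<bullet> z\<close> is the dual norm of \<open>y\<close>, and because \<open>z\<close> lives
  where the eigenvalues of \<open>X\<close> are negative, \<open>S = Q diag(z) Q\<^sup>T\<close> satisfies
  \<open>S \<bullet> X = - (y \<bullet> z)\<close>. It is feasible since its eigenvalue vector is \<open>z\<close> up to a permutation.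

  The substance is the lower bound for an arbitrary feasible \<open>T\<close>. Only the diagonal
  \<open>d\<close> of \<open>Q\<^sup>T T Q\<close> enters \<open>T \<bullet> X\<close>; it is nonnegative, so \<open>T \<bullet> X \<ge> - (y \<bullet> d)\<close>. Diagonalizing
  \<open>T = P diag(w) P\<^sup>T\<close> gives \<open>d = D w\<close>, where the matrix \<open>D\<close> of the squared entries of the orthogonal
  matrix \<open>Q\<^sup>T P\<close> is doubly stochastic. A rearrangement inequality for doubly stochastic matrices
  (\<open>doubly_stochastic_rearrangement\<close>) yields \<open>y \<bullet> D w \<le> y \<bullet> v\<close> for some permutation \<open>v\<close> of
  \<open>w\<close>, and \<open>v\<close> lies in the unit ball of \<open>\<phi>\<close>, so \<open>y \<bullet> v \<le> y \<bullet> z\<close>.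

  The rearrangement inequality is proved by linear programming duality rather than by the
  Birkhoff decomposition into permutation matrices: two similarly ordered families are
  cyclically monotone and so have a potential \<open>g\<close>, which serves as a dual certificate for the
  assignment problem (\<open>similarly_ordered_potential\<close>). The eigenvalue vectors in the statement
  are sorted roots of characteristic polynomials; the spectral theorem
  (\<open>symmetric_matrix_diagonalizable\<close>) and the uniqueness of sorted root vectors
  (\<open>mono_vec_eq_if_linear_factors_eq\<close>) connect them with diagonalizations.
\<close>

section \<open>Similarly ordered families\<close>

text \<open>
  The inequality says that \<open>b i\<close> is a subgradient at \<open>a i\<close> of a convex function taking the value
  \<open>g i\<close> there. The points are added in increasing order of \<open>a + b\<close>, which for similarly ordered
  families increases both coordinates even in the presence of ties; each step extends the
  function linearly, with the slope of the new point.
\<close>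
lemma similarly_ordered_potential:
  fixes a b :: "'a \<Rightarrow> real"
  assumes "finite A" and "\<And>i j. 0 \<le> (a i - a j) * (b i - b j)"
  shows "\<exists>g. \<forall>i\<in>A. \<forall>k\<in>A. b i * (a k - a i) \<le> g k - g i"
  using assms(1)
proof (induction rule: finite_ranking_induct[where f = "\<lambda>i. a i + b i"])
  case empty
  then show ?case by simp
next
  case (insert x S)
  have mono: "a i \<le> a j \<and> b i \<le> b j" if "a i + b i \<le> a j + b j" for i j
    using assms(2)[of i j] that by (auto simp: zero_le_mult_iff)
  consider "x \<in> S" | "S = {}" | "x \<notin> S" "S \<noteq> {}" by blast
  then show ?case
  proof cases
    case 1
    then show ?thesis using insert.IH by (simp add: insert_absorb)
  next
    case 2
    then show ?thesis by auto
  next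
    case 3
    obtain g where g: "\<forall>i\<in>S. \<forall>k\<in>S. b i * (a k - a i) \<le> g k - g i"
      using insert.IH by blast
    have "Max ((\<lambda>i. a i + b i) ` S) \<in> (\<lambda>i. a i + b i) ` S"
      using insert.hyps(1) 3 by (intro Max_in) auto
    then obtain m where m: "m \<in> S" "Max ((\<lambda>i. a i + b i) ` S) = a m + b m" by auto
    have max_m: "a i \<le> a m \<and> b i \<le> b m" if "i \<in> S" for i
      using Max_ge[of "(\<lambda>i. a i + b i) ` S" "a i + b i"] m(2) that insert.hyps(1)
      by (intro mono) auto
    have le_x: "a m \<le> a x" "b m \<le> b x"
      using mono[OF insert.hyps(2)[OF m(1)]] by auto
    define h where "h = g(x := g m + b x * (a x - a m))"
    have up: "b i * (a x - a i) \<le> h x - h i" if "i \<in> S" for i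
    proof -
      have "b i * (a m - a i) \<le> g m - g i" using g m(1) that by blast
      moreover have "b i * (a x - a m) \<le> b x * (a x - a m)"
        using max_m[OF that] le_x by (intro mult_right_mono) auto
      ultimately show ?thesis
        using that 3(1) by (auto simp: h_def algebra_simps)
    qed
    have down: "b x * (a i - a x) \<le> h i - h x" if "i \<in> S" for i
    proof -
      have "b m * (a i - a m) \<le> g i - g m" using g m(1) that by blast
      moreover have "b m * (a m - a i) \<le> b x * (a m - a i)"
        using max_m[OF that] le_x by (intro mult_right_mono) auto
      ultimately show ?thesis
        using that 3(1) by (auto simp: h_def algebra_simps)
    qed
    have "h i = g i" if "i \<in> S" for i
      using that 3(1) by (auto simp: h_def)
    then have "\<forall>i\<in>insert x S. \<forall>k\<in>insert x S. b i * (a k - a i) \<le> h k - h i"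
      using up down g by auto
    then show ?thesis by blast
  qed
qed

text \<open>
  Averaging the potential inequality with the weights \<open>D\<close> makes the potential cancel, since the
  row and column sums of \<open>D\<close> agree.
\<close>
lemma doubly_stochastic_rearrangement:
  fixes a b :: "'a::finite \<Rightarrow> real" and D :: "'a \<Rightarrow> 'a \<Rightarrow> real"
  assumes ord: "\<And>i j. 0 \<le> (a i - a j) * (b i - b j)"
    and nonneg: "\<And>i j. 0 \<le> D i j"
    and rows: "\<And>i. (\<Sum>j\<in>UNIV. D i j) = 1"
    and cols: "\<And>j. (\<Sum>i\<in>UNIV. D i j) = 1"
  shows "(\<Sum>i\<in>UNIV. \<Sum>j\<in>UNIV. a i * D i j * b j) \<le> (\<Sum>i\<in>UNIV. a i * b i)"
proof -
  obtain g where g: "\<And>i k. b i * (a k - a i) \<le> g k - g i"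
    using similarly_ordered_potential[of UNIV a b] ord by auto
  have row_sum: "(\<Sum>i\<in>UNIV. \<Sum>j\<in>UNIV. D i j * f i) = (\<Sum>i\<in>UNIV. f i)" for f :: "'a \<Rightarrow> real"
    by (simp add: sum_distrib_right[symmetric] rows)
  have col_sum: "(\<Sum>i\<in>UNIV. \<Sum>j\<in>UNIV. D i j * f j) = (\<Sum>j\<in>UNIV. f j)" for f :: "'a \<Rightarrow> real"
    by (subst sum.swap) (simp add: sum_distrib_right[symmetric] cols)
  have "(\<Sum>i\<in>UNIV. \<Sum>j\<in>UNIV. D i j * (b j * (a i - a j)))
      \<le> (\<Sum>i\<in>UNIV. \<Sum>j\<in>UNIV. D i j * (g i - g j))"
    by (intro sum_mono mult_left_mono g nonneg)
  also have "\<dots> = 0"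
    by (simp add: right_diff_distrib sum_subtractf row_sum col_sum)
  finally have "(\<Sum>i\<in>UNIV. \<Sum>j\<in>UNIV. D i j * (b j * (a i - a j))) \<le> 0" .
  moreover have "(\<Sum>i\<in>UNIV. \<Sum>j\<in>UNIV. D i j * (b j * (a i - a j)))
      = (\<Sum>i\<in>UNIV. \<Sum>j\<in>UNIV. a i * D i j * b j) - (\<Sum>j\<in>UNIV. a j * b j)"
    using col_sum[of "\<lambda>j. a j * b j"]
    by (simp add: algebra_simps sum_subtractf)
  ultimately show ?thesis by simp
qed

text \<open>
  A permutation maximizing \<open>\<Sum>i. a i * b (p i)\<close> works: an inversion could be removed by a
  transposition, which would increase the sum.
\<close>
lemma similarly_ordering_permutation:
  fixes a b :: "'a::finite \<Rightarrow> real"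
  obtains p where "p permutes UNIV" "\<And>i j. 0 \<le> (a i - a j) * (b (p i) - b (p j))"
proof -
  define F where "F p = (\<Sum>i\<in>UNIV. a i * b (p i))" for p
  have fin: "finite {p. p permutes (UNIV :: 'a set)}" by (simp add: finite_permutations)
  have ne: "{p. p permutes (UNIV :: 'a set)} \<noteq> {}" using permutes_id by blast
  have "Max (F ` {p. p permutes UNIV}) \<in> F ` {p. p permutes UNIV}"
    using fin ne by (intro Max_in) auto
  then obtain p where p: "p permutes UNIV" "F p = Max (F ` {p. p permutes UNIV})" by auto
  have best: "F q \<le> F p" if "q permutes UNIV" for q
    unfolding p(2) using fin that by (intro Max_ge) auto
  have "0 \<le> (a i - a j) * (b (p i) - b (p j))" for i j
  proof (cases "i = j")
    case False
    define t where "t = Transposition.transpose i j"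
    have t: "t permutes UNIV" unfolding t_def by (rule permutes_swap_id) auto
    have split: "(\<Sum>k\<in>UNIV. f k) = f i + f j + (\<Sum>k\<in>UNIV - {i,j}. f k)" for f :: "'a \<Rightarrow> real"
      using False sum.subset_diff[of "{i,j}" UNIV f] by simp
    have "F (p \<circ> t) \<le> F p" by (intro best permutes_compose t p)
    moreover have "F p - F (p \<circ> t) = (a i - a j) * (b (p i) - b (p j))"
      unfolding F_def split by (simp add: t_def algebra_simps)
    ultimately show ?thesis by simp
  qed simp
  then show ?thesis using that p(1) by blast
qed

text \<open>
  Sorting is the special case in which the first family is the rank of the index.
\<close>
lemma sorting_permutation:
  fixes b :: "'a::{finite,linorder} \<Rightarrow> real"
  obtains p where "p permutes UNIV" "mono (\<lambda>i. b (p i))"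
proof -
  obtain p where p: "p permutes UNIV"
    "\<And>i j. 0 \<le> (real (card {..<i}) - real (card {..<j})) * (b (p i) - b (p j))"
    using similarly_ordering_permutation[of "\<lambda>i. real (card {..<i})" b] by blast
  have "b (p i) \<le> b (p j)" if "i \<le> j" for i j
  proof (cases "i = j")
    case False
    then have "card {..<i} < card {..<j}"
      using that by (intro psubset_card_mono) auto
    then show ?thesis using p(2)[of i j] by (simp add: zero_le_mult_iff)
  qed simp
  then have "mono (\<lambda>i. b (p i))" by (intro monoI)
  then show ?thesis using that p(1) by blast
qed

section \<open>The spectral theorem for real symmetric matrices\<close>

lemma symmetric_matrix_self_adjoint:
  fixes A :: "real^'n^'n"
  assumes "A \<in> sym_matrices"
  shows "x \<bullet> (A *v z) = (A *v x) \<bullet> z"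
  using assms dot_lmul_matrix[of x A z] vector_transpose_matrix[of x A]
  by (simp add: sym_matrices_def)

text \<open>
  A maximizer \<open>u\<close> of the quadratic form on the unit sphere of the subspace is an eigenvector:
  with \<open>M\<close> the maximum, \<open>B = M I - A\<close> is nonnegative on the subspace and its form vanishes at
  \<open>u\<close>, so \<open>u\<close> minimizes that form and \<open>B u\<close> must be zero.
\<close>
lemma symmetric_eigenvector_in_invariant_subspace:
  fixes A :: "real^'n^'n"
  assumes sym: "A \<in> sym_matrices" and V: "subspace V" "\<And>x. x \<in> V \<Longrightarrow> A *v x \<in> V"
    and nz: "y \<in> V" "y \<noteq> 0"
  obtains u w where "u \<in> V" "norm u = 1" "A *v u = w *\<^sub>R u"
proof -
  let ?K = "V \<inter> sphere 0 1"
  have "compact ?K"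
    by (intro closed_Int_compact closed_subspace V) auto
  moreover have "(1 / norm y) *\<^sub>R y \<in> ?K"
    using nz V(1) by (auto simp: subspace_scale)
  moreover have "continuous_on ?K (\<lambda>x. x \<bullet> (A *v x))"
    by (intro continuous_intros linear_continuous_on_compose[OF continuous_on_id] matrix_vector_mul_linear)
  ultimately obtain u where u: "u \<in> ?K" "\<And>x. x \<in> ?K \<Longrightarrow> x \<bullet> (A *v x) \<le> u \<bullet> (A *v u)"
    using continuous_attains_sup[of ?K "\<lambda>x. x \<bullet> (A *v x)"] by blast
  define M where "M = u \<bullet> (A *v u)"
  note self = symmetric_matrix_self_adjoint[OF sym]
  define B where "B x = M *\<^sub>R x - A *v x" for x
  have quad: "0 \<le> x \<bullet> B x" if "x \<in> V" for x
  proof (cases "x = 0")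
    case False
    have "(1 / norm x) *\<^sub>R x \<in> ?K"
      using that False V(1) by (auto simp: subspace_scale)
    from u(2)[OF this] have "(1 / norm x)\<^sup>2 * (x \<bullet> (A *v x)) \<le> M"
      by (simp add: M_def matrix_vector_mult_scaleR power2_eq_square)
    then have "x \<bullet> (A *v x) \<le> M * (norm x)\<^sup>2"
      using False by (simp add: field_simps)
    then show ?thesis by (simp add: B_def inner_diff_right power2_norm_eq_inner)
  qed (simp add: B_def)
  have Bu: "u \<bullet> B u = 0"
    using u(1) by (simp add: B_def M_def inner_diff_right dot_square_norm)
  have uV: "u \<in> V" and BV: "B u \<in> V"
    using u(1) V by (auto simp: B_def subspace_diff subspace_scale)
  have add: "B (x + z) = B x + B z" and scl: "B (c *\<^sub>R x) = c *\<^sub>R B x" for x z c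
    by (simp_all add: B_def matrix_vector_right_distrib matrix_vector_mult_scaleR algebra_simps)
  have symB: "x \<bullet> B z = B x \<bullet> z" for x z
    by (simp add: B_def inner_diff_right inner_diff_left self)
  have "B u = 0"
  proof (rule ccontr)
    assume "B u \<noteq> 0"
    define c where "c = B u \<bullet> B u"
    define d where "d = B u \<bullet> B (B u)"
    have c: "0 < c" using \<open>B u \<noteq> 0\<close> by (simp add: c_def)
    have d: "0 \<le> d" using quad[OF BV] by (simp add: d_def)
    have pos: "0 \<le> 2 * t * c + t\<^sup>2 * d" for t
    proof -
      have "0 \<le> (u + t *\<^sub>R B u) \<bullet> B (u + t *\<^sub>R B u)"
        by (intro quad subspace_add subspace_scale V uV BV)
      also have "\<dots> = 2 * t * c + t\<^sup>2 * d"
        using Bu symB[of u "B u"]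
        by (simp add: add scl inner_add_left inner_add_right c_def d_def power2_eq_square algebra_simps)
      finally show ?thesis .
    qed
    \<comment> \<open>For small negative \<open>t\<close> the linear term wins; this step \<open>t = - c / (d + 1)\<close> is small enough.\<close>
    have "2 * (- (c / (d + 1))) * c + (- (c / (d + 1)))\<^sup>2 * d = - (c\<^sup>2 * (d + 2) / (d + 1)\<^sup>2)"
      using d by (simp add: divide_simps power2_eq_square) (simp add: algebra_simps)
    moreover have "0 < c\<^sup>2 * (d + 2) / (d + 1)\<^sup>2" using c d by simp
    ultimately show False using pos[of "- (c / (d + 1))"] by linarith
  qed
  then have "A *v u = M *\<^sub>R u" by (simp add: B_def)
  then show ?thesis using that uV u(1) by simp
qed

lemma matrix_conjugate_diag_nth:
  fixes P :: "real^'n^'n"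
  shows "(P ** diag_matrix w ** transpose P) $ a $ b = (\<Sum>i\<in>UNIV. w $ i * P $ a $ i * P $ b $ i)"
  by (simp add: matrix_matrix_mult_def diag_matrix_def transpose_def if_distrib[of "\<lambda>x. _ * x"] 
        mult_ac cong: if_cong)

text \<open>
  Orthonormal eigenvectors are found one at a time, each inside the orthogonal complement of
  those already found, which is invariant because the matrix is self-adjoint. Running the
  induction over finite sets of indices labels the eigenvectors by the matrix index type itself.
\<close>
theorem symmetric_matrix_diagonalizable:
  fixes A :: "real^'n^'n"
  assumes sym: "A \<in> sym_matrices"
  obtains P w where "orthogonal_matrix P" "A = P ** diag_matrix w ** transpose P"
proof -
  define E where "E f l K \<longleftrightarrow> (\<forall>i\<in>K. norm (f i) = 1 \<and> A *v f i = l i *\<^sub>R f i)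
      \<and> (\<forall>i\<in>K. \<forall>j\<in>K. i \<noteq> j \<longrightarrow> orthogonal (f i) (f j))"
    for f :: "'n \<Rightarrow> real^'n" and l :: "'n \<Rightarrow> real" and K
  note self = symmetric_matrix_self_adjoint[OF sym]
  have "\<exists>f l. E f l K" if "finite K" for K
    using that
  proof (induction K)
    case (insert k K)
    obtain f l where fl: "E f l K" using insert.IH by blast
    let ?V = "{x. \<forall>i\<in>K. f i \<bullet> x = 0}"
    have "dim (f ` K) \<le> card K"
      using dim_le_card'[of "f ` K"] card_image_le[of K f] insert.hyps by auto
    also have "\<dots> < CARD('n)"
      using insert.hyps by (intro psubset_card_mono) auto
    finally have "dim (f ` K) < DIM(real^'n)" by simp
    then obtain y where y: "y \<noteq> 0" "\<And>z. z \<in> span (f ` K) \<Longrightarrow> orthogonal y z"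
      using orthogonal_to_subspace_exists by blast
    have "y \<in> ?V"
      using y(2) by (auto simp: orthogonal_def inner_commute[of _ y] span_base)
    moreover have "subspace ?V"
      by (auto simp: subspace_def inner_add_right)
    moreover have "A *v x \<in> ?V" if "x \<in> ?V" for x
      using that fl by (auto simp: self E_def)
    ultimately obtain u w where u: "u \<in> ?V" "norm u = 1" "A *v u = w *\<^sub>R u"
      using symmetric_eigenvector_in_invariant_subspace[OF sym, of ?V y] y(1) by blast
    have "E (f(k := u)) (l(k := w)) (insert k K)"
      using fl u insert.hyps
      by (auto simp: E_def orthogonal_def inner_commute)
    then show ?case by blast
  qed (simp add: E_def)
  from this[OF finite] obtain f l where fl: "E f l UNIV" by blast
  define P where "P = (\<chi> i j. f j $ i)"
  define w where "w = (\<chi> i. l i)"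
  have col: "column i P = f i" for i
    by (simp add: P_def column_def vec_eq_iff)
  have P: "orthogonal_matrix P"
    using fl unfolding orthogonal_matrix_orthonormal_columns col by (auto simp: E_def)
  have "A ** P = P ** diag_matrix w"
  proof -
    have "(A ** P) $ i $ j = (A *v f j) $ i" for i j
      by (simp add: matrix_matrix_mult_def matrix_vector_mult_def P_def)
    also have "(A *v f j) $ i = (P ** diag_matrix w) $ i $ j" for i j
      using fl by (simp add: E_def matrix_matrix_mult_def diag_matrix_def P_def w_def
          if_distrib[of "\<lambda>x. _ * x"] mult_ac cong: if_cong)
    finally show ?thesis by (simp add: vec_eq_iff)
  qed
  then have "A ** P ** transpose P = P ** diag_matrix w ** transpose P" by simp
  then have "A = P ** diag_matrix w ** transpose P"
    using P by (simp add: orthogonal_matrix_def flip: matrix_mul_assoc)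
  then show ?thesis using that P by blast
qed

section \<open>Eigenvalue vectors\<close>

text \<open>
  The polynomials determine the multisets of entries. A nondecreasing vector is then recovered
  from the numbers of its entries below each threshold.
\<close>
lemma mono_vec_eq_if_linear_factors_eq:
  fixes v w :: "real^'n::{finite,linorder}"
  assumes mono: "mono (($) v)" "mono (($) w)"
    and eq: "\<And>t::real. (\<Prod>i\<in>UNIV. t - v $ i) = (\<Prod>i\<in>UNIV. t - w $ i)"
  shows "v = w"
proof -
  define p where "p u = (\<Prod>i\<in>UNIV. [:- (u $ i), 1:])" for u :: "real^'n::{finite,linorder}"
  have single: "(\<Sum>i\<in>A. {#f i#}) = image_mset f (mset_set A)" if "finite A"
    for f :: "'n \<Rightarrow> real" and A
    using that by induction auto
  have roots: "proots (p u) = image_mset (($) u) (mset_set UNIV)" for u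
    by (simp add: p_def proots_prod single)
  have "p v = p w"
    using eq by (simp add: poly_eq_poly_eq_iff[symmetric] fun_eq_iff p_def poly_prod)
  then have mset: "image_mset (($) v) (mset_set UNIV) = image_mset (($) w) (mset_set UNIV)"
    by (simp flip: roots)
  have count: "card {j. u $ j \<le> a} = size (filter_mset (\<lambda>x. x \<le> a) (image_mset (($) u) (mset_set UNIV)))"
    for u :: "real^'n::{finite,linorder}" and a
    by (simp add: filter_mset_image_mset o_def filter_mset_mset_set)
  have cards: "card {j. v $ j \<le> a} = card {j. w $ j \<le> a}" for a
    by (simp add: count mset)
  have le: "y $ i \<le> x $ i"
    if "mono (($) x)" "mono (($) y)" "\<And>a. card {j. x $ j \<le> a} = card {j. y $ j \<le> a}"
    for x y :: "real^'n::{finite,linorder}" and i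
  proof (rule ccontr)
    assume "\<not> y $ i \<le> x $ i"
    then have "{j. y $ j \<le> x $ i} \<subseteq> {..<i}"
      using monoD[OF that(2), of i] by (force simp: not_less[symmetric])
    moreover have "{..i} \<subseteq> {j. x $ j \<le> x $ i}"
      using monoD[OF that(1)] by auto
    ultimately have "card {..i} \<le> card {..<i}"
      using card_mono[of "{j. x $ j \<le> x $ i}" "{..i}"] card_mono[of "{..<i}" "{j. y $ j \<le> x $ i}"]
        that(3)[of "x $ i"] by simp
    moreover have "card {..<i} < card {..i}"
      by (intro psubset_card_mono) auto
    ultimately show False by simp
  qed
  show ?thesis
    using le[OF mono cards] le[OF mono(2,1) cards[symmetric]] by (simp add: vec_eq_iff order_antisym)
qed

lemma charpoly_conjugate_diag:
  fixes P :: "real^'n^'n"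
  assumes "orthogonal_matrix P"
  shows "det (t *\<^sub>R mat 1 - P ** diag_matrix w ** transpose P) = (\<Prod>i\<in>UNIV. t - w $ i)"
proof -
  have PP: "P ** transpose P = mat 1"
    using assms by (simp add: orthogonal_matrix_def)
  define D where "D = diag_matrix (\<chi> i. t - w $ i)"
  have "P ** D ** transpose P = t *\<^sub>R (P ** transpose P) - P ** diag_matrix w ** transpose P"
  proof -
    have "(P ** transpose P) $ a $ b = (\<Sum>i\<in>UNIV. P $ a $ i * P $ b $ i)" for a b
      by (simp add: matrix_matrix_mult_def transpose_def)
    then show ?thesis
      by (simp add: D_def vec_eq_iff matrix_conjugate_diag_nth algebra_simps sum_subtractf
          sum_distrib_left)
  qed
  then have "t *\<^sub>R mat 1 - P ** diag_matrix w ** transpose P = P ** D ** transpose P"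
    by (simp add: PP)
  moreover have "det (P ** D ** transpose P) = det (P ** transpose P) * det D"
    by (simp only: det_mul mult_ac)
  moreover have "det D = (\<Prod>i\<in>UNIV. t - w $ i)"
    by (simp add: D_def det_diagonal diag_matrix_def)
  ultimately show ?thesis by (simp add: PP)
qed

lemma eigvals_eqI:
  fixes A :: "real^'n::{finite,linorder}^'n::{finite,linorder}"
  assumes "mono (($) v)" and "\<And>t::real. det (t *\<^sub>R mat 1 - A) = (\<Prod>i\<in>UNIV. t - v $ i)"
  shows "eigvals A = v"
  unfolding eigvals_def
  using assms by (intro the_equality) (auto intro: mono_vec_eq_if_linear_factors_eq)

lemma eigvals_conjugate_diag:
  fixes P :: "real^'n::{finite,linorder}^'n::{finite,linorder}"
  assumes "orthogonal_matrix P"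
  obtains p where "p permutes UNIV" "eigvals (P ** diag_matrix w ** transpose P) = (\<chi> i. w $ p i)"
proof -
  obtain p where p: "p permutes UNIV" "mono (\<lambda>i. w $ p i)"
    using sorting_permutation by blast
  have "(\<Prod>i\<in>UNIV. t - w $ i) = (\<Prod>i\<in>UNIV. t - w $ p i)" for t
    using prod.permute[OF p(1), of "\<lambda>i. t - w $ i"] by (simp add: o_def)
  then have "eigvals (P ** diag_matrix w ** transpose P) = (\<chi> i. w $ p i)"
    using p(2) by (intro eigvals_eqI) (simp_all add: charpoly_conjugate_diag[OF assms] mono_def)
  then show ?thesis using that p(1) by blast
qed

lemma conjugate_diag_symmetric:
  fixes P :: "real^'n^'n"
  shows "P ** diag_matrix w ** transpose P \<in> sym_matrices"
  by (simp add: sym_matrices_def vec_eq_iff transpose_def[of "_ ** _"] matrix_conjugate_diag_nth mult_ac)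

lemma conjugate_diag_quadratic_form:
  fixes P :: "real^'n^'n"
  shows "x \<bullet> ((P ** diag_matrix w ** transpose P) *v x) = (\<Sum>i\<in>UNIV. w $ i * (column i P \<bullet> x)\<^sup>2)"
proof -
  have "x \<bullet> ((P ** diag_matrix w ** transpose P) *v x)
      = (\<Sum>a\<in>UNIV. \<Sum>b\<in>UNIV. \<Sum>i\<in>UNIV. w $ i * (P $ a $ i * x $ a) * (P $ b $ i * x $ b))"
    by (simp add: inner_vec_def matrix_vector_mult_def matrix_conjugate_diag_nth
        sum_distrib_left sum_distrib_right mult_ac)
  also have "\<dots> = (\<Sum>a\<in>UNIV. \<Sum>i\<in>UNIV. \<Sum>b\<in>UNIV. w $ i * (P $ a $ i * x $ a) * (P $ b $ i * x $ b))"
    by (intro sum.cong refl sum.swap)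
  also have "\<dots> = (\<Sum>i\<in>UNIV. \<Sum>a\<in>UNIV. \<Sum>b\<in>UNIV. w $ i * (P $ a $ i * x $ a) * (P $ b $ i * x $ b))"
    by (rule sum.swap)
  also have "\<dots> = (\<Sum>i\<in>UNIV. w $ i * (column i P \<bullet> x)\<^sup>2)"
    by (simp add: inner_vec_def column_def power2_eq_square sum_product sum_distrib_left mult_ac)
  finally show ?thesis .
qed

text \<open>
  \<open>P diag(w) P\<^sup>T\<close> is the sum of the rank-one matrices \<open>w\<^sub>i p\<^sub>i p\<^sub>i\<^sup>T\<close> over the columns of \<open>P\<close>, and the
  Frobenius product of \<open>p p\<^sup>T\<close> with \<open>Y\<close> is the quadratic form of \<open>Y\<close> at \<open>p\<close>.
\<close>
lemma conjugate_diag_inner: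
  fixes P Y :: "real^'n^'n"
  shows "(P ** diag_matrix w ** transpose P) \<bullet> Y = (\<Sum>i\<in>UNIV. w $ i * (column i P \<bullet> (Y *v column i P)))"
proof -
  have "(P ** diag_matrix w ** transpose P) \<bullet> Y
      = (\<Sum>a\<in>UNIV. \<Sum>b\<in>UNIV. \<Sum>i\<in>UNIV. w $ i * (P $ a $ i * (Y $ a $ b * P $ b $ i)))"
    by (simp add: inner_vec_def matrix_conjugate_diag_nth sum_distrib_left sum_distrib_right mult_ac)
  also have "\<dots> = (\<Sum>a\<in>UNIV. \<Sum>i\<in>UNIV. \<Sum>b\<in>UNIV. w $ i * (P $ a $ i * (Y $ a $ b * P $ b $ i)))"
    by (intro sum.cong refl sum.swap)
  also have "\<dots> = (\<Sum>i\<in>UNIV. \<Sum>a\<in>UNIV. \<Sum>b\<in>UNIV. w $ i * (P $ a $ i * (Y $ a $ b * P $ b $ i)))"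
    by (rule sum.swap)
  also have "\<dots> = (\<Sum>i\<in>UNIV. w $ i * (column i P \<bullet> (Y *v column i P)))"
    by (simp add: inner_vec_def column_def matrix_vector_mult_def sum_distrib_left)
  finally show ?thesis .
qed

lemma orthogonal_column_inner:
  fixes P :: "real^'n^'n"
  assumes "orthogonal_matrix P"
  shows "column i P \<bullet> column j P = (if i = j then 1 else 0)"
  using assms unfolding orthogonal_matrix_orthonormal_columns
  by (auto simp: orthogonal_def dot_square_norm)

lemma orthogonal_columns_parseval:
  fixes P :: "real^'n^'n"
  assumes "orthogonal_matrix P"
  shows "(\<Sum>i\<in>UNIV. (column i P \<bullet> x)\<^sup>2) = x \<bullet> x"
proof -
  have "diag_matrix (\<chi> i. 1) = (mat 1 :: real^'n^'n)"
    by (simp add: diag_matrix_def mat_def vec_eq_iff)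
  then show ?thesis
    using conjugate_diag_quadratic_form[of x P "\<chi> i. 1"] assms
    by (simp add: orthogonal_matrix_def)
qed

lemma conjugate_diag_psd_iff:
  fixes P :: "real^'n^'n"
  assumes "orthogonal_matrix P"
  shows "P ** diag_matrix w ** transpose P \<in> psd_matrices \<longleftrightarrow> (\<forall>i. 0 \<le> w $ i)"
proof
  assume psd: "P ** diag_matrix w ** transpose P \<in> psd_matrices"
  show "\<forall>i. 0 \<le> w $ i"
  proof
    fix k
    have "(\<Sum>i\<in>UNIV. w $ i * (column i P \<bullet> column k P)\<^sup>2) = w $ k"
      by (simp add: orthogonal_column_inner[OF assms] if_distrib[of "\<lambda>x. x\<^sup>2"]
          if_distrib[of "\<lambda>x. _ * x"] cong: if_cong)
    moreover have "0 \<le> column k P \<bullet> ((P ** diag_matrix w ** transpose P) *v column k P)"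
      using psd unfolding psd_matrices_def by blast
    ultimately show "0 \<le> w $ k"
      using conjugate_diag_quadratic_form[of "column k P" P w] by simp
  qed
next
  assume "\<forall>i. 0 \<le> w $ i"
  then show "P ** diag_matrix w ** transpose P \<in> psd_matrices"
    unfolding psd_matrices_def
    by (simp add: conjugate_diag_symmetric conjugate_diag_quadratic_form sum_nonneg)
qed

section \<open>Symmetric gauges\<close>

text \<open>
  The maximum defining the dual norm is attained because the unit ball is compact. Both halves
  rest on continuity, which comes from convexity: a finite convex function on a Euclidean space
  is continuous.
\<close>
lemma is_norm_continuous:
  assumes "is_norm \<phi>"
  shows "continuous_on UNIV \<phi>"
proof (rule convex_on_continuous)
  show "convex_on UNIV \<phi>"
  proof (rule convex_onI)
    fix t :: real and x y
    assume t: "0 < t" "t < 1"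
    have "\<phi> ((1 - t) *\<^sub>R x + t *\<^sub>R y) \<le> \<phi> ((1 - t) *\<^sub>R x) + \<phi> (t *\<^sub>R y)"
      using assms unfolding is_norm_def by blast
    also have "\<dots> = \<bar>1 - t\<bar> * \<phi> x + \<bar>t\<bar> * \<phi> y"
      using assms by (simp only: is_norm_def)
    finally show "\<phi> ((1 - t) *\<^sub>R x + t *\<^sub>R y) \<le> (1 - t) * \<phi> x + t * \<phi> y"
      using t by simp
  qed simp
qed simp

lemma is_norm_compact_unit_ball:
  fixes \<phi> :: "real^'n \<Rightarrow> real"
  assumes "is_norm \<phi>"
  shows "compact {z. \<phi> z \<le> 1}"
proof -
  note cont = is_norm_continuous[OF assms]
  have "sphere 0 1 \<noteq> ({} :: (real^'n) set)"
    by simp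
  then obtain u where u: "u \<in> sphere 0 1" "\<And>x. x \<in> sphere 0 1 \<Longrightarrow> \<phi> u \<le> \<phi> x"
    using continuous_attains_inf[of "sphere 0 1" \<phi>] continuous_on_subset[OF cont] by force
  have "u \<noteq> 0" using u(1) by auto
  then have pos: "0 < \<phi> u"
    using assms unfolding is_norm_def by (metis less_eq_real_def)
  have "norm z \<le> 1 / \<phi> u" if "\<phi> z \<le> 1" for z
  proof (cases "z = 0")
    case True
    then show ?thesis using pos by simp
  next
    case False
    have "\<phi> u \<le> \<phi> ((1 / norm z) *\<^sub>R z)" using False by (intro u(2)) simp
    also have "\<dots> = \<bar>1 / norm z\<bar> * \<phi> z" using assms by (simp only: is_norm_def)
    also have "\<dots> \<le> 1 / norm z" using that False by (simp add: divide_simps)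
    finally show ?thesis using False pos by (simp add: field_simps)
  qed
  then have "bounded {z. \<phi> z \<le> 1}" by (auto simp: bounded_iff)
  moreover have "closed {z. \<phi> z \<le> 1}"
    using cont by (intro closed_Collect_le) auto
  ultimately show ?thesis by (simp add: compact_eq_bounded_closed)
qed

text \<open>
  Erasing coordinates averages the vector with the one whose signs are flipped there, and the
  two have the same gauge.
\<close>
lemma symmetric_gauge_restrict_le:
  fixes \<phi> :: "real^'n \<Rightarrow> real"
  assumes "symmetric_gauge \<phi>"
  shows "\<phi> (\<chi> i. if i \<in> I then z $ i else 0) \<le> \<phi> z"
proof -
  define f where "f = (\<chi> i. if i \<in> I then z $ i else - (z $ i))"
  have abs: "\<phi> x = \<phi> (\<chi> i. \<bar>x $ i\<bar>)" for x
    using assms by (simp add: symmetric_gauge_def)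
  have nrm: "\<phi> (c *\<^sub>R x) = \<bar>c\<bar> * \<phi> x" "\<phi> (x + y) \<le> \<phi> x + \<phi> y" for c x y
    using assms by (simp_all add: symmetric_gauge_def is_norm_def)
  have "(\<chi> i. \<bar>f $ i\<bar>) = (\<chi> i. \<bar>z $ i\<bar>)"
    by (simp add: f_def vec_eq_iff)
  then have "\<phi> f = \<phi> z" using abs[of f] abs[of z] by simp
  moreover have "(\<chi> i. if i \<in> I then z $ i else 0) = (1/2) *\<^sub>R (z + f)"
    by (simp add: f_def vec_eq_iff)
  ultimately show ?thesis using nrm(1)[of "1/2" "z + f"] nrm(2)[of z f] by simp
qed

text \<open>
  For nonnegative \<open>y\<close>, taking absolute values of a maximizer and erasing it off the support of
  \<open>y\<close> keeps it a maximizer.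
\<close>
lemma symmetric_gauge_dual_norm_maximizer:
  fixes \<phi> :: "real^'n \<Rightarrow> real"
  assumes gauge: "symmetric_gauge \<phi>" and y: "\<And>i. 0 \<le> y $ i"
  obtains z where "\<And>i. 0 \<le> z $ i" "\<phi> z \<le> 1" "vec_support z \<subseteq> vec_support y"
    "\<And>x. \<phi> x \<le> 1 \<Longrightarrow> y \<bullet> x \<le> y \<bullet> z" "dual_norm \<phi> y = y \<bullet> z"
proof -
  have nrm: "is_norm \<phi>" and abs: "\<And>x. \<phi> (\<chi> i. \<bar>x $ i\<bar>) = \<phi> x"
    using gauge by (simp_all add: symmetric_gauge_def)
  have "\<phi> 0 = 0" using nrm unfolding is_norm_def by blast
  then have "\<phi> 0 \<le> 1" by simp
  then have "{z. \<phi> z \<le> 1} \<noteq> {}" by blast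
  moreover have "continuous_on {z. \<phi> z \<le> 1} (\<lambda>z. y \<bullet> z)"
    by (intro continuous_intros)
  ultimately obtain u where u: "\<phi> u \<le> 1" "\<And>x. \<phi> x \<le> 1 \<Longrightarrow> y \<bullet> x \<le> y \<bullet> u"
    using continuous_attains_sup[OF is_norm_compact_unit_ball[OF nrm], of "\<lambda>z. y \<bullet> z"] by auto
  define z where "z = (\<chi> i. if i \<in> vec_support y then \<bar>u $ i\<bar> else 0)"
  have "\<phi> z \<le> \<phi> (\<chi> i. \<bar>u $ i\<bar>)"
    using symmetric_gauge_restrict_le[OF gauge, of "vec_support y" "\<chi> i. \<bar>u $ i\<bar>"]
    by (simp add: z_def cong: if_cong)
  then have ball: "\<phi> z \<le> 1" using u(1) by (simp add: abs)
  have "y \<bullet> u \<le> y \<bullet> z"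
    unfolding inner_vec_def
  proof (rule sum_mono)
    fix i
    show "y $ i \<bullet> u $ i \<le> y $ i \<bullet> z $ i"
      using mult_left_mono[OF abs_ge_self[of "u $ i"] y[of i]]
      by (simp add: z_def vec_support_def)
  qed
  then have max: "y \<bullet> x \<le> y \<bullet> z" if "\<phi> x \<le> 1" for x
    using u(2)[OF that] by simp
  have nonneg: "0 \<le> z $ i" for i by (simp add: z_def)
  have supp: "vec_support z \<subseteq> vec_support y" by (auto simp: z_def vec_support_def)
  have "dual_norm \<phi> y = y \<bullet> z"
    unfolding dual_norm_def
  proof (rule Greatest_equality)
    have "0 \<le> y \<bullet> z" using max[of 0] \<open>\<phi> 0 \<le> 1\<close> by simp
    then show "y \<bullet> z \<in> {\<bar>y \<bullet> z\<bar> | z. \<phi> z \<le> 1}"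
      using ball by force
  next
    fix r
    assume "r \<in> {\<bar>y \<bullet> z\<bar> | z. \<phi> z \<le> 1}"
    then obtain x where x: "r = \<bar>y \<bullet> x\<bar>" "\<phi> x \<le> 1" by blast
    have "\<phi> (- x) = \<phi> x"
      using abs[of x] abs[of "- x"] by simp
    then show "r \<le> y \<bullet> z"
      using max[of x] max[of "- x"] x by simp
  qed
  then show ?thesis
    using that[of z] nonneg ball max supp by blast
qed

section \<open>Spectral-gauge separation\<close>

text \<open>
  The numbers \<open>column i Q \<bullet> (S *v column i Q)\<close> are the diagonal of \<open>Q\<^sup>T S Q\<close>. They arise from the
  eigenvalues of \<open>S\<close> by the doubly stochastic matrix of squared inner products of the two
  orthonormal bases, which is the easy half of the Schur--Horn theorem.
\<close>
lemma weighted_diagonal_le_permuted_spectrum: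
  fixes P Q :: "real^'n^'n" and y :: "real^'n"
  assumes P: "orthogonal_matrix P" and Q: "orthogonal_matrix Q"
    and S: "S = P ** diag_matrix w ** transpose P"
  obtains p where "p permutes UNIV"
    "(\<Sum>i\<in>UNIV. y $ i * (column i Q \<bullet> (S *v column i Q))) \<le> y \<bullet> (\<chi> i. w $ p i)"
proof -
  obtain p where p: "p permutes (UNIV :: 'n set)"
    "\<And>i j. 0 \<le> (y $ i - y $ j) * (w $ p i - w $ p j)"
    using similarly_ordering_permutation[of "($) y" "($) w"] by blast
  define D where "D i j = (column j P \<bullet> column i Q)\<^sup>2" for i j
  have perm: "(\<Sum>j\<in>UNIV. f (p j)) = (\<Sum>j\<in>UNIV. f j)" for f :: "'n \<Rightarrow> real"
    using sum.permute[OF p(1), of f] by (simp add: o_def)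
  have rows: "(\<Sum>j\<in>UNIV. D i j) = 1" for i
    using orthogonal_columns_parseval[OF P, of "column i Q"]
    by (simp add: D_def orthogonal_column_inner[OF Q])
  have cols: "(\<Sum>i\<in>UNIV. D i j) = 1" for j
    using orthogonal_columns_parseval[OF Q, of "column j P"]
    by (simp add: D_def orthogonal_column_inner[OF P] inner_commute)
  \<comment> \<open>Permuting the columns of \<open>D\<close> along with \<open>w\<close> makes the two families similarly ordered.\<close>
  have "(\<Sum>i\<in>UNIV. y $ i * (column i Q \<bullet> (S *v column i Q)))
      = (\<Sum>i\<in>UNIV. \<Sum>j\<in>UNIV. y $ i * D i j * w $ j)"
    by (simp add: S conjugate_diag_quadratic_form D_def sum_distrib_left mult_ac)
  also have "\<dots> = (\<Sum>i\<in>UNIV. \<Sum>j\<in>UNIV. y $ i * D i (p j) * w $ p j)"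
    by (intro sum.cong refl perm[symmetric])
  also have "\<dots> \<le> (\<Sum>i\<in>UNIV. y $ i * w $ p i)"
    using rows cols perm[of "D _"]
    by (intro doubly_stochastic_rearrangement p(2)) (simp_all, simp add: D_def)
  finally show ?thesis using that p(1) by (simp add: inner_vec_def)
qed

theorem theorem3p3:
  fixes \<phi> :: "real^'n::{finite,linorder} \<Rightarrow> real"
    and X Q :: "real^'n::{finite,linorder}^'n::{finite,linorder}"
  assumes "symmetric_gauge \<phi>"
    and "X \<in> sym_matrices"
    and "orthogonal_matrix Q"
    and "X = Q ** diag_matrix (eigvals X) ** transpose Q"
  shows "gauge_gap \<phi> X = - dual_norm \<phi> (neg_spectrum X) \<and>
    (\<exists>S z.
       is_arg_min (\<lambda>S. S \<bullet> X) (\<lambda>S. S \<in> psd_matrices \<inter> gauge_ball \<phi>) S \<and>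
       S = Q ** diag_matrix z ** transpose Q \<and>
       is_arg_max (\<lambda>z. neg_spectrum X \<bullet> z) (\<lambda>z. (\<forall>i. 0 \<le> z $ i) \<and> \<phi> z \<le> 1) z \<and>
       vec_support z \<subseteq> vec_support (neg_spectrum X) \<and>
       ((gauge_gap \<phi> X = 0 \<and> X \<in> psd_matrices) \<or>
        (gauge_gap \<phi> X < 0 \<and> (\<forall>Y\<in>psd_matrices. 0 \<le> S \<bullet> Y) \<and> S \<bullet> X < 0)))"
proof -
  define l where "l = eigvals X"
  define y where "y = neg_spectrum X"
  have y_nth: "y $ i = max (- (l $ i)) 0" for i
    by (simp add: y_def l_def neg_spectrum_def)
  have X: "X = Q ** diag_matrix l ** transpose Q" using assms(4) by (simp add: l_def)
  note Q = assms(3)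
  have perm: "\<phi> (\<chi> i. z $ p i) = \<phi> z" if "p permutes UNIV" for p z
    using assms(1) that by (simp add: symmetric_gauge_def)
  obtain z where z: "\<And>i. 0 \<le> z $ i" "\<phi> z \<le> 1" "vec_support z \<subseteq> vec_support y"
    "\<And>x. \<phi> x \<le> 1 \<Longrightarrow> y \<bullet> x \<le> y \<bullet> z" "dual_norm \<phi> y = y \<bullet> z"
    using symmetric_gauge_dual_norm_maximizer[OF assms(1), of y] by (auto simp: y_nth)
  define S where "S = Q ** diag_matrix z ** transpose Q"
  have S_inner: "S \<bullet> Y = (\<Sum>i\<in>UNIV. z $ i * (column i Q \<bullet> (Y *v column i Q)))" for Y
    unfolding S_def by (rule conjugate_diag_inner)
  have "S \<bullet> X = (\<Sum>i\<in>UNIV. z $ i * l $ i)"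
    unfolding S_inner X
    by (simp add: conjugate_diag_quadratic_form orthogonal_column_inner[OF Q]
        if_distrib[of "\<lambda>x. x\<^sup>2"] if_distrib[of "\<lambda>x. _ * x"] cong: if_cong)
  also have "\<dots> = (\<Sum>i\<in>UNIV. - (y $ i * z $ i))"
  proof (rule sum.cong[OF refl])
    fix i
    show "z $ i * l $ i = - (y $ i * z $ i)"
      using z(3) by (auto simp: vec_support_def y_nth max_def split: if_splits)
  qed
  finally have SX: "S \<bullet> X = - (y \<bullet> z)" by (simp add: inner_vec_def sum_negf)
  obtain p where "p permutes UNIV" "eigvals S = (\<chi> i. z $ p i)"
    unfolding S_def using eigvals_conjugate_diag[OF Q] by blast
  then have S_feas: "S \<in> psd_matrices \<inter> gauge_ball \<phi>"
    using z(1,2) perm unfolding gauge_ball_def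
    by (simp add: S_def conjugate_diag_psd_iff[OF Q] conjugate_diag_symmetric)
  have lower: "- (y \<bullet> z) \<le> T \<bullet> X" if T: "T \<in> psd_matrices \<inter> gauge_ball \<phi>" for T
  proof -
    have "T \<in> sym_matrices" using T by (simp add: psd_matrices_def)
    then obtain P w where P: "orthogonal_matrix P" and TP: "T = P ** diag_matrix w ** transpose P"
      using symmetric_matrix_diagonalizable by blast
    obtain q where "q permutes UNIV" "eigvals T = (\<chi> i. w $ q i)"
      unfolding TP using eigvals_conjugate_diag[OF P] by blast
    then have w: "\<phi> w \<le> 1" using T perm by (simp add: gauge_ball_def)
    obtain p where p: "p permutes UNIV"
      "(\<Sum>i\<in>UNIV. y $ i * (column i Q \<bullet> (T *v column i Q))) \<le> y \<bullet> (\<chi> i. w $ p i)"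
      using weighted_diagonal_le_permuted_spectrum[OF P Q TP] by blast
    have "y \<bullet> (\<chi> i. w $ p i) \<le> y \<bullet> z" using p(1) w perm by (intro z(4)) simp
    moreover have "- (\<Sum>i\<in>UNIV. y $ i * (column i Q \<bullet> (T *v column i Q))) \<le> X \<bullet> T"
      unfolding X conjugate_diag_inner sum_negf[symmetric]
    proof (rule sum_mono)
      fix i
      have "0 \<le> column i Q \<bullet> (T *v column i Q)" using T by (simp add: psd_matrices_def)
      then show "- (y $ i * (column i Q \<bullet> (T *v column i Q))) \<le> l $ i * (column i Q \<bullet> (T *v column i Q))"
        using mult_right_mono[of "- (y $ i)" "l $ i" "column i Q \<bullet> (T *v column i Q)"]
        by (simp add: y_nth)
    qed
    ultimately show ?thesis using p(2) by (simp add: inner_commute)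
  qed
  have gap: "gauge_gap \<phi> X = - (y \<bullet> z)"
    unfolding gauge_gap_def
    using S_feas SX lower by (intro Least_equality) force+
  have argmin: "is_arg_min (\<lambda>S. S \<bullet> X) (\<lambda>S. S \<in> psd_matrices \<inter> gauge_ball \<phi>) S"
    using S_feas lower by (auto simp: is_arg_min_linorder SX)
  have argmax: "is_arg_max (\<lambda>z. y \<bullet> z) (\<lambda>z. (\<forall>i. 0 \<le> z $ i) \<and> \<phi> z \<le> 1) z"
    using z(1,2,4) by (auto simp: is_arg_max_linorder)
  have "(gauge_gap \<phi> X = 0 \<and> X \<in> psd_matrices) \<or>
        (gauge_gap \<phi> X < 0 \<and> (\<forall>Y\<in>psd_matrices. 0 \<le> S \<bullet> Y) \<and> S \<bullet> X < 0)"
  proof (cases "y = 0")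
    case True
    then have "0 \<le> l $ i" for i using y_nth[of i] by (simp add: max_def split: if_splits)
    then have "X \<in> psd_matrices" unfolding X by (simp add: conjugate_diag_psd_iff[OF Q])
    then show ?thesis using True gap by simp
  next
    case False
    then have pos: "0 < \<phi> y"
      using assms(1) unfolding symmetric_gauge_def is_norm_def by (metis less_eq_real_def)
    have scale: "\<phi> ((1 / \<phi> y) *\<^sub>R y) = \<bar>1 / \<phi> y\<bar> * \<phi> y"
      using assms(1) by (simp only: symmetric_gauge_def is_norm_def)
    \<comment> \<open>The maximum is positive because \<open>y\<close> itself, normalized, is a competitor.\<close>
    have "0 < y \<bullet> ((1 / \<phi> y) *\<^sub>R y)" using False pos by simp
    also have "\<dots> \<le> y \<bullet> z" using pos scale by (intro z(4)) simp
    finally have "0 < y \<bullet> z" .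
    moreover have "0 \<le> S \<bullet> Y" if "Y \<in> psd_matrices" for Y
      unfolding S_inner using that z(1) by (intro sum_nonneg) (simp add: psd_matrices_def)
    ultimately show ?thesis using gap SX by simp
  qed
  then show ?thesis
    using gap argmin argmax z(3,5) S_def unfolding y_def by auto
qed

end
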